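(* There exists a randomized query algorithm that learns any hidden matrix $M\in\mathcal{H}_n$, always outputs $M$ correctly, and makes $O(n\log^2 n)$ edge queries in expectation on every input. There also exists a quantum query algorithm that always outputs $M$ correctly and makes $O(n\log n)$ queries in expectation on every input $M\in\mathcal{H}_n$.
   Context: Let $L_n$ be the $n\times n$ 0-1 matrix with $L_n(i,j)=1$ iff $i\ge j$. $\mathcal{H}_n$ is the set of all matrices obtained from $L_n$ by an arbitrary row permutation together with an arbitrary column permutation. These are the bipartite adjacency matrices of half graphs on parts $[n],[n]$. An edge query on $(i,j)\in[n]\times[n]$ returns the entry $M(i,j)$ of the hidden matrix. Quantum queries are the unitary $|(i,j)\rangle|b\rangle\mapsto|(i,j)\rangle|b\oplus M(i,j)\rangle$. Intermediate measurements are allowed, and the cost is the expected number of queries maximized over inputs. Logarithms are base 2. *)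

theory Defs
  imports
    "HOL-Probability.Probability_Mass_Function"
    "HOL-Library.Landau_Symbols"
    "HOL-Combinatorics.Permutations"
    "Jordan_Normal_Form.Matrix"
    "Jordan_Normal_Form.Schur_Decomposition"
begin

section \<open>Half-graph matrices\<close>

text \<open>Matrix indices start at 0, so the index set is \<open>{..<n}\<close>.\<close>

definition half_graph_mat :: "nat \<Rightarrow> nat mat" where
  "half_graph_mat n = mat n n (\<lambda>(i, j). if i \<ge> j then 1 else 0)"

definition half_graph_mats :: "nat \<Rightarrow> nat mat set" where
  "half_graph_mats n =
     {mat n n (\<lambda>(i, j). half_graph_mat n $$ (p i, q j)) | p q.
        p permutes {..<n} \<and> q permutes {..<n}}"


section \<open>Randomized query algorithms\<close>

text \<open>A randomized query algorithm is a probability distribution over deterministic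
  decision trees. \<open>Ask i j t0 t1\<close> queries entry \<open>(i, j)\<close> and continues with \<open>t0\<close> or \<open>t1\<close>
  if the entry is 0 or 1, respectively. Each tree is finite, but a distribution may have
  trees of unbounded depth in its support.\<close>

datatype decision_tree =
    Answer "nat mat"
  | Ask nat nat decision_tree decision_tree

primrec valid_tree :: "nat \<Rightarrow> decision_tree \<Rightarrow> bool" where
  "valid_tree n (Answer X) = True"
| "valid_tree n (Ask i j t0 t1) = (i < n \<and> j < n \<and> valid_tree n t0 \<and> valid_tree n t1)"

primrec tree_output :: "nat mat \<Rightarrow> decision_tree \<Rightarrow> nat mat" where
  "tree_output M (Answer X) = X"
| "tree_output M (Ask i j t0 t1) =
     (if M $$ (i, j) = 0 then tree_output M t0 else tree_output M t1)"

primrec tree_queries :: "nat mat \<Rightarrow> decision_tree \<Rightarrow> nat" where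
  "tree_queries M (Answer X) = 0"
| "tree_queries M (Ask i j t0 t1) =
     Suc (if M $$ (i, j) = 0 then tree_queries M t0 else tree_queries M t1)"

definition randomized_learner :: "nat \<Rightarrow> decision_tree pmf \<Rightarrow> bool" where
  "randomized_learner n R \<longleftrightarrow>
     (\<forall>t \<in> set_pmf R. valid_tree n t \<and> (\<forall>M \<in> half_graph_mats n. tree_output M t = M))"

definition randomized_expected_queries :: "nat mat \<Rightarrow> decision_tree pmf \<Rightarrow> ennreal" where
  "randomized_expected_queries M R =
     (\<integral>\<^sup>+ t. ennreal (real (tree_queries M t)) \<partial>measure_pmf R)"


section \<open>Quantum query algorithms\<close>

text \<open>The register has basis states \<open>|(i, j)\<rangle>|b\<rangle>|w\<rangle>\<close> with \<open>i, j < n\<close>, \<open>b < 2\<close>, and a workspace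
  index \<open>w < W\<close>; they are numbered by the mixed-radix code below.\<close>

definition reg_dim :: "nat \<Rightarrow> nat \<Rightarrow> nat" where
  "reg_dim n W = n * n * 2 * W"

definition reg_code :: "nat \<Rightarrow> nat \<Rightarrow> nat \<Rightarrow> nat \<Rightarrow> nat \<Rightarrow> nat \<Rightarrow> nat" where
  "reg_code n W i j b w = ((i * n + j) * 2 + b) * W + w"

text \<open>The matrix of \<open>|(i, j)\<rangle>|b\<rangle>|w\<rangle> \<mapsto> |(i, j)\<rangle>|b \<oplus> M(i, j)\<rangle>|w\<rangle>\<close>: column \<open>c\<close> holds the image
  of the basis state with number \<open>c\<close>.\<close>

definition query_mat :: "nat \<Rightarrow> nat \<Rightarrow> nat mat \<Rightarrow> complex mat" where
  "query_mat n W M = mat (reg_dim n W) (reg_dim n W)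
     (\<lambda>(r, c). if \<exists>i<n. \<exists>j<n. \<exists>b<2. \<exists>w<W.
                    c = reg_code n W i j b w \<and>
                    r = reg_code n W i j ((b + M $$ (i, j)) mod 2) w
                then 1 else 0)"

text \<open>A quantum program interleaves queries, input-independent unitaries and measurements,
  and continues adaptively after a measurement. \<open>Measure m K A\<close> performs the general quantum
  measurement with operators \<open>K 0, \<dots>, K (m - 1)\<close> and continues with \<open>A k\<close> on outcome \<open>k\<close>
  (values of \<open>K\<close> and \<open>A\<close> at \<open>k \<ge> m\<close> are irrelevant). The number of queries may depend on the
  outcomes. Every program has bounded depth; this only makes existence claims stronger, and
  loops that run until success are covered by cutting them off and then querying all entries.\<close>

datatype qprog =
    Output "nat mat"
  | Query qprog
  | Unitary "complex mat" qprog
  | Measure nat "nat \<Rightarrow> complex mat" "nat \<Rightarrow> qprog"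

definition is_unitary :: "nat \<Rightarrow> complex mat \<Rightarrow> bool" where
  "is_unitary d U \<longleftrightarrow> U \<in> carrier_mat d d \<and> mat_adjoint U * U = 1\<^sub>m d"

definition is_measurement :: "nat \<Rightarrow> nat \<Rightarrow> (nat \<Rightarrow> complex mat) \<Rightarrow> bool" where
  "is_measurement d m K \<longleftrightarrow>
     (\<forall>k<m. K k \<in> carrier_mat d d) \<and>
     mat d d (\<lambda>(r, c). \<Sum>k<m. (mat_adjoint (K k) * K k) $$ (r, c)) = 1\<^sub>m d"

primrec valid_qprog :: "nat \<Rightarrow> qprog \<Rightarrow> bool" where
  "valid_qprog d (Output X) = True"
| "valid_qprog d (Query A) = valid_qprog d A"
| "valid_qprog d (Unitary U A) = (is_unitary d U \<and> valid_qprog d A)"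
| "valid_qprog d (Measure m K A) = (is_measurement d m K \<and> (\<forall>k<m. valid_qprog d (A k)))"

definition sq_norm_state :: "complex vec \<Rightarrow> real" where
  "sq_norm_state \<psi> = Re (\<psi> \<bullet>c \<psi>)"

text \<open>States are not renormalized after a measurement. With a unit initial state, the squared
  norm of the current state is therefore the probability that the computation reaches the
  current point of the program. Hence the sums below are the probability that the program
  outputs \<open>Y\<close> and the expected number of executed queries; \<open>Q\<close> is the query unitary.\<close>

primrec output_prob :: "complex mat \<Rightarrow> nat mat \<Rightarrow> qprog \<Rightarrow> complex vec \<Rightarrow> real" where
  "output_prob Q Y (Output X) \<psi> = (if X = Y then sq_norm_state \<psi> else 0)"
| "output_prob Q Y (Query A) \<psi> = output_prob Q Y A (Q *\<^sub>v \<psi>)"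
| "output_prob Q Y (Unitary U A) \<psi> = output_prob Q Y A (U *\<^sub>v \<psi>)"
| "output_prob Q Y (Measure m K A) \<psi> = (\<Sum>k<m. output_prob Q Y (A k) (K k *\<^sub>v \<psi>))"

primrec expected_queries :: "complex mat \<Rightarrow> qprog \<Rightarrow> complex vec \<Rightarrow> real" where
  "expected_queries Q (Output X) \<psi> = 0"
| "expected_queries Q (Query A) \<psi> = sq_norm_state \<psi> + expected_queries Q A (Q *\<^sub>v \<psi>)"
| "expected_queries Q (Unitary U A) \<psi> = expected_queries Q A (U *\<^sub>v \<psi>)"
| "expected_queries Q (Measure m K A) \<psi> = (\<Sum>k<m. expected_queries Q (A k) (K k *\<^sub>v \<psi>))"

text \<open>A quantum query algorithm is a workspace dimension with a program, started in
  \<open>|(0, 0)\<rangle>|0\<rangle>|0\<rangle>\<close>.\<close>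

definition initial_state :: "nat \<Rightarrow> nat \<Rightarrow> complex vec" where
  "initial_state n W = unit_vec (reg_dim n W) (reg_code n W 0 0 0 0)"

definition quantum_learner :: "nat \<Rightarrow> nat \<Rightarrow> qprog \<Rightarrow> bool" where
  "quantum_learner n W A \<longleftrightarrow>
     W \<ge> 1 \<and> valid_qprog (reg_dim n W) A \<and>
     (\<forall>M \<in> half_graph_mats n. output_prob (query_mat n W M) M A (initial_state n W) = 1)"

definition quantum_expected_queries :: "nat \<Rightarrow> nat \<Rightarrow> nat mat \<Rightarrow> qprog \<Rightarrow> real" where
  "quantum_expected_queries n W M A = expected_queries (query_mat n W M) A (initial_state n W)"

end

theory Submission
  imports Defs "HOL-Analysis.Harmonic_Numbers" "HOL-Real_Asymp.Real_Asymp"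
begin

text \<open>Process the rows in uniformly random order, and for each row the columns in uniformly random
  order; query an entry only if the earlier answers do not determine it. The entry of a row \<open>r\<close> and
  a column \<open>c\<close> with \<open>d\<close> rows between them in the order of the half graph is determined as soon as
  some row \<open>r'\<close> from the half of this interval next to \<open>c\<close> comes before \<open>r\<close> and some column \<open>c'\<close> from
  the half next to \<open>r\<close> comes before \<open>c\<close>: then \<open>M(r,c') = M(r',c) \<noteq> M(r',c')\<close>. Each of these fails with
  probability at most \<open>2/(d+1)\<close>, so the expected number of queries is at most \<open>8 n H\<^sub>n = O(n log n)\<close>.
  This is stronger than the randomized bound of the theorem, and the quantum algorithm only has to
  simulate a uniform mixture of decision trees.\<close>

section \<open>Asking only undetermined entries\<close>

lemma half_graph_matsE:
  assumes "X \<in> half_graph_mats n"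
  obtains p q where "p permutes {..<n}" "q permutes {..<n}"
    "\<And>i j. i < n \<Longrightarrow> j < n \<Longrightarrow> X $$ (i, j) = (if q j \<le> p i then 1 else 0)"
    "X \<in> carrier_mat n n"
proof -
  from assms obtain p q where p: "p permutes {..<n}" and q: "q permutes {..<n}"
    and X: "X = mat n n (\<lambda>(i, j). half_graph_mat n $$ (p i, q j))"
    by (auto simp: half_graph_mats_def)
  have "p i < n" "q i < n" if "i < n" for i
    using permutes_in_image[OF p] permutes_in_image[OF q] that by auto
  then show thesis
    using that[OF p q] by (simp add: X half_graph_mat_def)
qed

text \<open>A half graph has no induced matching of size two, and neither has its bipartite complement.\<close>

lemma half_graph_mats_forced:
  assumes "X \<in> half_graph_mats n" "i < n" "j < n" "i' < n" "j' < n"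
    and "X $$ (i, j') = X $$ (i', j)" "X $$ (i', j') \<noteq> X $$ (i', j)"
  shows "X $$ (i, j) = X $$ (i', j)"
  using assms by (elim half_graph_matsE) (auto split: if_splits)

lemma half_graph_mats_lt_2:
  assumes "M \<in> half_graph_mats n" "i < n" "j < n"
  shows "M $$ (i, j) < 2"
  using half_graph_matsE[OF assms(1)] assms(2,3) by (metis one_less_numeral_iff semiring_norm(76) zero_less_numeral)

text \<open>\<open>H\<close> holds the candidates consistent with the answers so far. They are split
  only by whether an entry vanishes, as in the branching of \<open>Ask\<close>; the choice at the
  leaf is harmless once a single candidate is left.\<close>

primrec learn_tree :: "(nat \<times> nat) list \<Rightarrow> nat mat set \<Rightarrow> decision_tree" where
  "learn_tree [] H = Answer (SOME X. X \<in> H)"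
| "learn_tree (e # es) H =
     (if (\<forall>X\<in>H. X $$ e = 0) \<or> (\<forall>X\<in>H. X $$ e \<noteq> 0) then learn_tree es H
      else Ask (fst e) (snd e) (learn_tree es {X \<in> H. X $$ e = 0}) (learn_tree es {X \<in> H. X $$ e \<noteq> 0}))"

lemma valid_learn_tree:
  "set es \<subseteq> {..<n} \<times> {..<n} \<Longrightarrow> valid_tree n (learn_tree es H)"
  by (induction es arbitrary: H) auto

text \<open>That the pending entries single out \<open>M\<close> in \<open>H\<close> is an
  invariant: a skipped entry has the same zero status in all of \<open>H\<close>, and an asked one
  has been used to filter \<open>H\<close>.\<close>

lemma tree_output_learn_tree:
  assumes "M \<in> H" "\<And>X. X \<in> H \<Longrightarrow> (\<And>e. e \<in> set es \<Longrightarrow> X $$ e = 0 \<longleftrightarrow> M $$ e = 0) \<Longrightarrow> X = M"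
  shows "tree_output M (learn_tree es H) = M"
  using assms
proof (induction es arbitrary: H)
  case Nil
  then have "(SOME X. X \<in> H) = M" by (metis empty_iff empty_set someI)
  then show ?case by simp
next
  case (Cons e es)
  show ?case
  proof (cases "(\<forall>X\<in>H. X $$ e = 0) \<or> (\<forall>X\<in>H. X $$ e \<noteq> 0)")
    case True
    have "tree_output M (learn_tree es H) = M"
    proof (rule Cons.IH[OF Cons.prems(1)])
      fix X assume X: "X \<in> H" "\<And>e. e \<in> set es \<Longrightarrow> X $$ e = 0 \<longleftrightarrow> M $$ e = 0"
      have "X $$ e' = 0 \<longleftrightarrow> M $$ e' = 0" if "e' \<in> set (e # es)" for e'
        using that X True Cons.prems(1) by (cases "e' = e") auto
      then show "X = M" using X(1) Cons.prems(2) by blast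
    qed
    with True show ?thesis by simp
  next
    case False
    have "tree_output M (learn_tree es {X \<in> H. X $$ e = 0 \<longleftrightarrow> M $$ e = 0}) = M"
    proof (rule Cons.IH)
      fix X assume X: "X \<in> {X \<in> H. X $$ e = 0 \<longleftrightarrow> M $$ e = 0}"
        "\<And>e. e \<in> set es \<Longrightarrow> X $$ e = 0 \<longleftrightarrow> M $$ e = 0"
      have "X $$ e' = 0 \<longleftrightarrow> M $$ e' = 0" if "e' \<in> set (e # es)" for e'
        using that X by (cases "e' = e") auto
      then show "X = M" using X(1) Cons.prems(2) by blast
    qed (use Cons.prems(1) in simp)
    with False show ?thesis by auto
  qed
qed

text \<open>\<open>B\<close> collects the entries that may cost a query; outside \<open>B\<close>,
  agreement with \<open>M\<close> on the earlier entries settles the entry. Each query uses up a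
  different element of \<open>B\<close>.\<close>

lemma tree_queries_learn_tree_le:
  assumes "M \<in> H" "finite B" "distinct es"
    and "\<And>ys e zs X. es = ys @ e # zs \<Longrightarrow> e \<notin> B \<Longrightarrow> X \<in> H \<Longrightarrow>
           (\<And>e'. e' \<in> set ys \<Longrightarrow> X $$ e' = 0 \<longleftrightarrow> M $$ e' = 0) \<Longrightarrow> X $$ e = 0 \<longleftrightarrow> M $$ e = 0"
  shows "tree_queries M (learn_tree es H) \<le> card B"
  using assms
proof (induction es arbitrary: H B)
  case Nil
  then show ?case by simp
next
  case (Cons e es)
  show ?case
  proof (cases "(\<forall>X\<in>H. X $$ e = 0) \<or> (\<forall>X\<in>H. X $$ e \<noteq> 0)")
    case True
    have "tree_queries M (learn_tree es H) \<le> card B"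
    proof (rule Cons.IH)
      fix ys e' zs X
      assume *: "es = ys @ e' # zs" "e' \<notin> B" "X \<in> H"
        "\<And>e'. e' \<in> set ys \<Longrightarrow> X $$ e' = 0 \<longleftrightarrow> M $$ e' = 0"
      show "X $$ e' = 0 \<longleftrightarrow> M $$ e' = 0"
      proof (rule Cons.prems(4)[of "e # ys" e' zs])
        show "X $$ e'' = 0 \<longleftrightarrow> M $$ e'' = 0" if "e'' \<in> set (e # ys)" for e''
          using that * True Cons.prems(1) by (cases "e'' = e") auto
      qed (use * in simp_all)
    qed (use Cons.prems in auto)
    with True show ?thesis by simp
  next
    case False
    \<comment> \<open>By the hypothesis for the empty prefix, an entry outside \<open>B\<close>
      would have constant zero status on \<open>H\<close> and not be asked.\<close>
    have eB: "e \<in> B"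
    proof (rule ccontr)
      assume "e \<notin> B"
      then have "\<forall>X\<in>H. X $$ e = 0 \<longleftrightarrow> M $$ e = 0"
        using Cons.prems(4)[of "[]" e es] by simp
      then show False using False by blast
    qed
    define H' where "H' = {X \<in> H. X $$ e = 0 \<longleftrightarrow> M $$ e = 0}"
    have "tree_queries M (learn_tree es H') \<le> card (B - {e})"
    proof (rule Cons.IH)
      fix ys e' zs X
      assume *: "es = ys @ e' # zs" "e' \<notin> B - {e}" "X \<in> H'"
        "\<And>e'. e' \<in> set ys \<Longrightarrow> X $$ e' = 0 \<longleftrightarrow> M $$ e' = 0"
      show "X $$ e' = 0 \<longleftrightarrow> M $$ e' = 0"
      proof (rule Cons.prems(4)[of "e # ys" e' zs])
        show "X $$ e'' = 0 \<longleftrightarrow> M $$ e'' = 0" if "e'' \<in> set (e # ys)" for e''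
          using that * by (cases "e'' = e") (auto simp: H'_def)
      qed (use * Cons.prems(3) in \<open>auto simp: H'_def\<close>)
    qed (use Cons.prems in \<open>auto simp: H'_def\<close>)
    then have "Suc (tree_queries M (learn_tree es H')) \<le> card B"
      using eB Cons.prems(2) card_Suc_Diff1 by fastforce
    with False show ?thesis by (auto simp: H'_def)
  qed
qed

section \<open>Scanning the entries row by row\<close>

definition scan :: "nat \<Rightarrow> (nat \<Rightarrow> nat) \<Rightarrow> (nat \<Rightarrow> nat) \<Rightarrow> (nat \<times> nat) list" where
  "scan n a b = map (\<lambda>k. (a (k div n), b (k mod n))) [0..<n * n]"

lemma set_scan:
  assumes "a permutes {..<n}" "b permutes {..<n}"
  shows "set (scan n a b) = {..<n} \<times> {..<n}"
proof (intro equalityI subrelI)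
  fix i j assume "(i, j) \<in> set (scan n a b)"
  then obtain k where k: "k < n * n" "i = a (k div n)" "j = b (k mod n)"
    by (auto simp: scan_def)
  then have "k div n < n" "k mod n < n"
    by (simp add: less_mult_imp_div_less) (metis k(1) mod_less_divisor mult_0 not_gr0 not_less0)
  then show "(i, j) \<in> {..<n} \<times> {..<n}"
    using permutes_in_image[OF assms(1), of "k div n"] permutes_in_image[OF assms(2), of "k mod n"]
    by (simp add: k)
next
  fix i j assume "(i, j) \<in> {..<n} \<times> {..<n}"
  then have "i \<in> a ` {..<n}" "j \<in> b ` {..<n}"
    using permutes_image[OF assms(1)] permutes_image[OF assms(2)] by simp_all
  then obtain s t where st: "s < n" "t < n" "i = a s" "j = b t" by auto
  have "Suc s * n \<le> n * n" using st(1) by (intro mult_le_mono1) simp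
  then have "s * n + t \<in> {0..<n * n}" using st(2) by simp
  moreover have "(i, j) = (\<lambda>k. (a (k div n), b (k mod n))) (s * n + t)" using st by simp
  ultimately show "(i, j) \<in> set (scan n a b)" unfolding scan_def set_map set_upt by blast
qed

lemma distinct_scan:
  assumes "a permutes {..<n}" "b permutes {..<n}"
  shows "distinct (scan n a b)"
proof -
  have "inj_on (\<lambda>k. (a (k div n), b (k mod n))) {0..<n * n}"
  proof (rule inj_onI)
    fix k l
    assume "(a (k div n), b (k mod n)) = (a (l div n), b (l mod n))"
    then have "k div n = l div n" "k mod n = l mod n"
      using permutes_inj[OF assms(1)] permutes_inj[OF assms(2)] by (auto dest: injD)
    then show "k = l" by (metis div_mult_mod_eq)
  qed
  then show ?thesis by (simp add: scan_def distinct_map)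
qed

text \<open>The entry \<open>(i', j')\<close> has position
  \<open>\<sigma> i' * n + \<tau> j'\<close> in the list, so positions are ordered by row time first
  and column time second.\<close>

lemma scan_prefix:
  assumes "\<sigma> permutes {..<n}" "\<tau> permutes {..<n}"
    and split: "scan n (Hilbert_Choice.inv \<sigma>) (Hilbert_Choice.inv \<tau>) = ys @ (i, j) # zs" and "i' < n" "j' < n"
    and before: "\<sigma> i' < \<sigma> i \<or> \<sigma> i' = \<sigma> i \<and> \<tau> j' < \<tau> j"
  shows "(i', j') \<in> set ys"
proof -
  let ?f = "\<lambda>k. (Hilbert_Choice.inv \<sigma> (k div n), Hilbert_Choice.inv \<tau> (k mod n))"
  let ?k = "length ys" and ?l = "\<sigma> i' * n + \<tau> j'"
  have lt: "\<sigma> i' < n" "\<tau> j' < n"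
    using assms permutes_in_image[OF assms(1), of i'] permutes_in_image[OF assms(2), of j'] by auto
  have len: "?k < n * n"
    using arg_cong[OF split, of length] by (simp add: scan_def)
  have "(i, j) = scan n (Hilbert_Choice.inv \<sigma>) (Hilbert_Choice.inv \<tau>) ! ?k" by (simp add: split)
  also have "\<dots> = ?f ?k" using len by (simp add: scan_def)
  finally have k: "\<sigma> i = ?k div n" "\<tau> j = ?k mod n"
    using assms(1,2) by (auto simp: permutes_inverses)
  have "?l < ?k"
  proof (cases "\<sigma> i' < \<sigma> i")
    case True
    then have "Suc (\<sigma> i') * n \<le> \<sigma> i * n" by (intro mult_le_mono1) simp
    then have "?l < \<sigma> i * n" using lt by simp
    also have "\<dots> \<le> ?k" by (simp add: k)
    finally show ?thesis .
  next
    case False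
    then have "?l < \<sigma> i * n + \<tau> j" using before by simp
    then show ?thesis by (simp add: k)
  qed
  moreover have "ys ! ?l = ?f ?l" if "?l < ?k"
  proof -
    have "ys ! ?l = scan n (Hilbert_Choice.inv \<sigma>) (Hilbert_Choice.inv \<tau>) ! ?l" using that by (simp add: split nth_append)
    then show ?thesis using that len by (simp add: scan_def)
  qed
  ultimately have "?l < length ys" "ys ! ?l = (i', j')"
    using lt assms(1,2) by (auto simp: permutes_inverses)
  then show ?thesis by (metis nth_mem)
qed

text \<open>\<open>\<sigma> i\<close> and \<open>\<tau> j\<close> are the times at which row \<open>i\<close> and column \<open>j\<close> are processed.\<close>

definition scan_tree :: "nat \<Rightarrow> (nat \<Rightarrow> nat) \<times> (nat \<Rightarrow> nat) \<Rightarrow> decision_tree" where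
  "scan_tree n = (\<lambda>(\<sigma>, \<tau>). learn_tree (scan n (Hilbert_Choice.inv \<sigma>) (Hilbert_Choice.inv \<tau>)) (half_graph_mats n))"

lemma valid_scan_tree:
  assumes "\<sigma> permutes {..<n}" "\<tau> permutes {..<n}"
  shows "valid_tree n (scan_tree n (\<sigma>, \<tau>))"
  using set_scan[OF assms[THEN permutes_inv]] by (simp add: scan_tree_def valid_learn_tree)

lemma half_graph_mats_eqI:
  assumes "X \<in> half_graph_mats n" "M \<in> half_graph_mats n"
    and eq: "\<And>i j. i < n \<Longrightarrow> j < n \<Longrightarrow> X $$ (i, j) = 0 \<longleftrightarrow> M $$ (i, j) = 0"
  shows "X = M"
proof -
  obtain p q :: "nat \<Rightarrow> nat" where X: "\<And>i j. i < n \<Longrightarrow> j < n \<Longrightarrow> X $$ (i, j) = (if q j \<le> p i then 1 else 0)"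
    "X \<in> carrier_mat n n"
    using half_graph_matsE[OF assms(1)] by metis
  obtain p' q' :: "nat \<Rightarrow> nat" where M: "\<And>i j. i < n \<Longrightarrow> j < n \<Longrightarrow> M $$ (i, j) = (if q' j \<le> p' i then 1 else 0)"
    "M \<in> carrier_mat n n"
    using half_graph_matsE[OF assms(2)] by metis
  show ?thesis
  proof (rule eq_matI)
    fix i j assume "i < dim_row M" "j < dim_col M"
    then have "i < n" "j < n" using M by auto
    from X(1)[OF this] M(1)[OF this] eq[OF this] show "X $$ (i, j) = M $$ (i, j)"
      by (auto split: if_splits)
  qed (use X M in auto)
qed

lemma tree_output_scan_tree:
  assumes "\<sigma> permutes {..<n}" "\<tau> permutes {..<n}" "M \<in> half_graph_mats n"
  shows "tree_output M (scan_tree n (\<sigma>, \<tau>)) = M"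
  using set_scan[OF assms(1,2)[THEN permutes_inv]] assms
  by (auto simp: scan_tree_def intro!: tree_output_learn_tree half_graph_mats_eqI)

text \<open>Given such earlier \<open>i'\<close> and \<open>j'\<close>, the three other entries of
  the 2 by 2 submatrix are scanned before \<open>(i, j)\<close>, and
  \<open>half_graph_mats_forced\<close> yields the last one for every candidate.\<close>

lemma tree_queries_scan_tree_le:
  assumes "\<sigma> permutes {..<n}" "\<tau> permutes {..<n}" "M \<in> half_graph_mats n"
  shows "tree_queries M (scan_tree n (\<sigma>, \<tau>)) \<le> card {(i, j) \<in> {..<n} \<times> {..<n}.
    \<not> (\<exists>i'<n. \<exists>j'<n. \<sigma> i' < \<sigma> i \<and> \<tau> j' < \<tau> j \<and>
         M $$ (i, j') = M $$ (i', j) \<and> M $$ (i', j') \<noteq> M $$ (i', j))}" (is "_ \<le> card ?B")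
  unfolding scan_tree_def split
proof (rule tree_queries_learn_tree_le)
  show "finite ?B" by (rule finite_subset[of _ "{..<n} \<times> {..<n}"]) auto
  show "distinct (scan n (Hilbert_Choice.inv \<sigma>) (Hilbert_Choice.inv \<tau>))" using assms by (simp add: distinct_scan permutes_inv)
  fix ys e zs X
  assume split: "scan n (Hilbert_Choice.inv \<sigma>) (Hilbert_Choice.inv \<tau>) = ys @ e # zs" and "e \<notin> ?B" and X: "X \<in> half_graph_mats n"
    and agree: "\<And>e'. e' \<in> set ys \<Longrightarrow> X $$ e' = 0 \<longleftrightarrow> M $$ e' = 0"
  obtain i j where e: "e = (i, j)" by fastforce
  have "e \<in> {..<n} \<times> {..<n}"
    using arg_cong[OF split, of set] set_scan[OF assms(1,2)[THEN permutes_inv]] by auto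
  then have ij: "i < n" "j < n" by (auto simp: e)
  with \<open>e \<notin> ?B\<close> obtain i' j' where ij': "i' < n" "j' < n" "\<sigma> i' < \<sigma> i" "\<tau> j' < \<tau> j"
    and M: "M $$ (i, j') = M $$ (i', j)" "M $$ (i', j') \<noteq> M $$ (i', j)"
    by (auto simp: e)
  have bit: "Y $$ (k, l) = 0 \<or> Y $$ (k, l) = 1" if "Y \<in> half_graph_mats n" "k < n" "l < n" for Y k l
    using that by (elim half_graph_matsE) (auto split: if_splits)
  \<comment> \<open>\<open>(i, j')\<close> is earlier in the same row; the other two lie in an
    earlier row, whatever their columns.\<close>
  have "(i, j') \<in> set ys" "(i', j) \<in> set ys" "(i', j') \<in> set ys"
    using ij ij' scan_prefix[OF assms(1,2) split[unfolded e]] by auto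
  then have *: "X $$ (i, j') = M $$ (i, j')" "X $$ (i', j) = M $$ (i', j)" "X $$ (i', j') = M $$ (i', j')"
    using agree bit[OF X] bit[OF assms(3)] ij ij' by metis+
  have "X $$ (i, j) = X $$ (i', j)" "M $$ (i, j) = M $$ (i', j)"
    using half_graph_mats_forced[OF X ij ij'(1,2)] half_graph_mats_forced[OF assms(3) ij ij'(1,2)] M
    by (simp_all add: *)
  then show "X $$ e = 0 \<longleftrightarrow> M $$ e = 0" by (simp add: e *)
qed (use assms in auto)

section \<open>Random orders\<close>

text \<open>Among the elements of \<open>insert x A\<close>, each is equally likely to come first.\<close>

lemma card_permutes_first_le:
  assumes "finite S" "insert x A \<subseteq> S" "x \<notin> A"
  shows "card {\<sigma>. \<sigma> permutes S \<and> (\<forall>y\<in>A. \<sigma> x \<le> (\<sigma> y :: 'a :: linorder))} * (card A + 1) \<le> fact (card S)"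
proof -
  let ?B = "insert x A"
  define E where "E z = {\<sigma>. \<sigma> permutes S \<and> (\<forall>y\<in>?B. \<sigma> z \<le> \<sigma> y)}" for z
  have fin: "finite {\<sigma>. \<sigma> permutes S}" using assms(1) by (rule finite_permutations)
  have finB: "finite ?B" by (rule finite_subset[OF assms(2,1)])
  have finE: "finite (E z)" for z by (rule finite_subset[OF _ fin]) (auto simp: E_def)
  \<comment> \<open>Swapping \<open>x\<close> and \<open>z\<close> injects \<open>E x\<close> into
    \<open>E z\<close>. The \<open>card A + 1\<close> events are disjoint and each at least as large
    as \<open>E x\<close>.\<close>
  have "card (E x) \<le> card (E z)" if "z \<in> ?B" for z
  proof (rule card_inj_on_le[where f = "\<lambda>\<sigma>. \<sigma> \<circ> Transposition.transpose x z"])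
    show "inj_on (\<lambda>\<sigma>. \<sigma> \<circ> Transposition.transpose x z) (E x)"
    proof (rule inj_on_inverseI)
      show "(\<sigma> \<circ> Transposition.transpose x z) \<circ> Transposition.transpose x z = \<sigma>" for \<sigma> :: "'a \<Rightarrow> 'a"
        by (simp add: comp_assoc)
    qed
    show "(\<lambda>\<sigma>. \<sigma> \<circ> Transposition.transpose x z) ` E x \<subseteq> E z"
    proof (intro image_subsetI)
      fix \<sigma> assume \<sigma>: "\<sigma> \<in> E x"
      have "Transposition.transpose x z permutes S" using assms(2) that by (intro permutes_swap_id) auto
      then have perm: "\<sigma> \<circ> Transposition.transpose x z permutes S"
        using \<sigma> by (auto simp: E_def intro: permutes_compose)
      have "Transposition.transpose x z y \<in> ?B" if "y \<in> ?B" for y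
        using that \<open>z \<in> ?B\<close> by (auto simp: Transposition.transpose_def)
      moreover have "\<sigma> x \<le> \<sigma> y" if "y \<in> ?B" for y
        using that \<sigma> by (auto simp: E_def)
      ultimately have "(\<sigma> \<circ> Transposition.transpose x z) z \<le> (\<sigma> \<circ> Transposition.transpose x z) y"
        if "y \<in> ?B" for y
        using that by simp
      with perm show "\<sigma> \<circ> Transposition.transpose x z \<in> E z"
        unfolding E_def by blast
    qed
  qed (rule finE)
  then have "card ?B * card (E x) \<le> (\<Sum>z\<in>?B. card (E z))"
    using sum_bounded_below[of ?B "card (E x)" "\<lambda>z. card (E z)"] by simp
  also have "\<dots> = card (\<Union>z\<in>?B. E z)"
  proof (rule card_UN_disjoint[symmetric])
    show "\<forall>z\<in>?B. \<forall>w\<in>?B. z \<noteq> w \<longrightarrow> E z \<inter> E w = {}"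
    proof (intro ballI impI equals0I)
      fix z w \<sigma> assume "z \<in> ?B" "w \<in> ?B" "z \<noteq> w" "\<sigma> \<in> E z \<inter> E w"
      then have "\<sigma> z = \<sigma> w" "\<sigma> permutes S" unfolding E_def by (auto intro: antisym)
      then show False using \<open>z \<noteq> w\<close> by (auto dest!: permutes_inj injD)
    qed
  qed (use finB finE in auto)
  also have "\<dots> \<le> card {\<sigma>. \<sigma> permutes S}" by (rule card_mono[OF fin]) (auto simp: E_def)
  also have "\<dots> = fact (card S)" using assms(1) by (simp add: card_permutations)
  finally have "card ?B * card (E x) \<le> fact (card S)" .
  moreover have "card ?B = card A + 1" using assms finB by simp
  moreover have "E x = {\<sigma>. \<sigma> permutes S \<and> (\<forall>y\<in>A. \<sigma> x \<le> \<sigma> y)}" by (auto simp: E_def)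
  ultimately show ?thesis by (simp add: mult.commute)
qed

text \<open>For a row of rank \<open>x\<close> and a column of rank \<open>y\<close>, the ranks strictly between them are cut in
  the middle: the rows of one half together with the columns of the other half determine the
  entry. The half that is used for the rows is the one next to the column.\<close>

definition row_blockers :: "nat \<Rightarrow> nat \<Rightarrow> nat set" where
  "row_blockers x y = (if y \<le> x then {y..<(x + y + 1) div 2} else {(x + y) div 2<..<y})"

definition col_blockers :: "nat \<Rightarrow> nat \<Rightarrow> nat set" where
  "col_blockers x y = (if y \<le> x then {(x + y + 1) div 2<..x} else {x<..(x + y) div 2})"

text \<open>In the order column 0, row 0, column 1, row 1 and so on, this counts the rows, and
  equally the columns, strictly between the row of rank \<open>x\<close> and the column of rank
  \<open>y\<close>. The cases differ by one because the diagonal of \<open>half_graph_mat\<close> is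
  1.\<close>

definition gap :: "nat \<Rightarrow> nat \<Rightarrow> nat" where
  "gap x y = (if y \<le> x then x - y else y - x - 1)"

section \<open>Sizes of the blocker sets and the harmonic sum\<close>

lemma row_blockers_subset: "x < n \<Longrightarrow> y < n \<Longrightarrow> row_blockers x y \<subseteq> {..<n}"
  by (rule subsetI) (auto simp: row_blockers_def split: if_splits)

lemma col_blockers_subset: "x < n \<Longrightarrow> y < n \<Longrightarrow> col_blockers x y \<subseteq> {..<n}"
  by (rule subsetI) (auto simp: col_blockers_def split: if_splits)

text \<open>Each blocker set has at least half the gap, rounded down. The summands bound the
  probabilities that the row, or the column, precedes all of its blockers.\<close>

lemma blockers_weight_le:
  "1 / real (card (row_blockers x y) + 1) + 1 / real (card (col_blockers x y) + 1) \<le> 4 / real (gap x y + 1)"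
proof -
  have "gap x y + 1 \<le> 2 * (card (row_blockers x y) + 1)" "gap x y + 1 \<le> 2 * (card (col_blockers x y) + 1)"
    by (auto simp: gap_def row_blockers_def col_blockers_def)
  moreover have *: "1 / real (k + 1) \<le> 2 / real (d + 1)" if "d + 1 \<le> 2 * (k + 1)" for d k :: nat
    using that by (simp add: field_simps)
  ultimately have "1 / real (card (row_blockers x y) + 1) \<le> 2 / real (gap x y + 1)"
    "1 / real (card (col_blockers x y) + 1) \<le> 2 / real (gap x y + 1)" by blast+
  from add_mono[OF this] show ?thesis by simp
qed

text \<open>For fixed \<open>x\<close>, every gap occurs at most once on either side of
  \<open>x\<close>, so up to the factor 4 both sides are partial harmonic sums.\<close>

lemma sum_gap_le: "(\<Sum>x<n. \<Sum>y<n. 4 / real (gap x y + 1)) \<le> 8 * real n * harm n"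
proof -
  have "(\<Sum>y<n. 4 / real (gap x y + 1)) \<le> 8 * harm n" if x: "x < n" for x
  proof -
    have h: "(\<Sum>k<m. 4 / real (k + 1)) \<le> 4 * harm n" if "m \<le> n" for m
    proof -
      have "(\<Sum>k<m. 4 / real (k + 1)) = 4 * harm m"
        by (simp add: harm_altdef sum_distrib_left divide_inverse add.commute)
      then show ?thesis using harm_mono[OF that] by simp
    qed
    have "(\<Sum>y<n. 4 / real (gap x y + 1)) =
        (\<Sum>y\<in>{..x}. 4 / real (gap x y + 1)) + (\<Sum>y\<in>{x<..<n}. 4 / real (gap x y + 1))"
      using x by (subst sum.union_disjoint[symmetric]) (auto intro!: sum.cong)
    also have "(\<Sum>y\<in>{..x}. 4 / real (gap x y + 1)) = (\<Sum>k<Suc x. 4 / real (k + 1))"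
      by (rule sum.reindex_bij_witness[where i = "\<lambda>k. x - k" and j = "\<lambda>y. x - y"]) (auto simp: gap_def)
    also have "(\<Sum>y\<in>{x<..<n}. 4 / real (gap x y + 1)) = (\<Sum>k<n - x - 1. 4 / real (k + 1))"
      by (rule sum.reindex_bij_witness[where i = "\<lambda>k. x + 1 + k" and j = "\<lambda>y. y - x - 1"]) (auto simp: gap_def)
    also have "(\<Sum>k<Suc x. 4 / real (k + 1)) + (\<Sum>k<n - x - 1. 4 / real (k + 1)) \<le> 4 * harm n + 4 * harm n"
      using x by (intro add_mono h) auto
    finally show ?thesis by simp
  qed
  then have "(\<Sum>x<n. \<Sum>y<n. 4 / real (gap x y + 1)) \<le> (\<Sum>x<n. 8 * harm n)"
    by (intro sum_mono) auto
  then show ?thesis by simp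
qed

lemma harm_bigo: "(\<lambda>n. harm n :: real) \<in> O(\<lambda>n. log 2 (real n))"
proof -
  \<comment> \<open>The induction step compares \<open>1/(n+1)\<close> with
    \<open>ln (n+1) - ln n\<close> through \<open>ln t \<le> t - 1\<close> at
    \<open>t = n/(n+1)\<close>.\<close>
  have "harm n \<le> 1 + ln (real n)" if "n \<ge> 1" for n :: nat
    using that
  proof (induction n rule: dec_induct)
    case base
    then show ?case by (simp add: harm_expand)
  next
    case (step n)
    have "inverse (real (Suc n)) \<le> ln (real (Suc n)) - ln (real n)"
    proof -
      have "ln (real n / real (Suc n)) \<le> real n / real (Suc n) - 1"
        using step by (intro ln_le_minus_one) auto
      also have "\<dots> = - inverse (real (Suc n))" by (simp add: field_simps)
      finally show ?thesis using step by (simp add: ln_div)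
    qed
    with step show ?case by (simp add: harm_Suc)
  qed
  then have "(\<lambda>n. harm n :: real) \<in> O(\<lambda>n. 1 + ln (real n))"
    by (intro bigoI[where c = 1] eventually_sequentiallyI[where c = 1]) (auto simp: harm_nonneg)
  also have "(\<lambda>n::nat. 1 + ln (real n)) \<in> O(\<lambda>n. log 2 (real n))" by real_asymp
  finally show ?thesis .
qed

text \<open>The queries are bounded by the number of entries whose row precedes all its row blockers
  or whose column precedes all its column blockers; a union bound over all pairs of orders then
  leads to the harmonic sum. The form as a finite sum serves the randomized and the quantum average
  alike.\<close>

lemma sum_permutes_scan_tree_le:
  assumes "M \<in> half_graph_mats n"
  defines "P \<equiv> {\<sigma>. \<sigma> permutes {..<n}}"
  shows "(\<Sum>s\<in>P \<times> P. real (tree_queries M (scan_tree n s))) \<le> real (card (P \<times> P)) * (8 * real n * harm n)"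
proof -
  obtain p q where p: "p permutes {..<n}" and q: "q permutes {..<n}"
    and M: "\<And>i j. i < n \<Longrightarrow> j < n \<Longrightarrow> M $$ (i, j) = (if q j \<le> p i then 1 else 0)"
    using half_graph_matsE[OF assms(1)] by metis
  have finP: "finite P" unfolding P_def by (rule finite_permutations) simp
  have cardP: "card P = fact n" by (simp add: P_def card_permutations)
  \<comment> \<open>Blockers are ranks; \<open>A\<close> and \<open>B\<close> pull them back to
    actual rows and columns.\<close>
  define A where "A i j = {i'. i' < n \<and> p i' \<in> row_blockers (p i) (q j)}" for i j
  define B where "B i j = {j'. j' < n \<and> q j' \<in> col_blockers (p i) (q j)}" for i j
  have lt: "p i < n" "q i < n" if "i < n" for i
    using permutes_in_image[OF p] permutes_in_image[OF q] that by auto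
  have card_preimage: "card {i. i < n \<and> f i \<in> S} = card S" if "f permutes {..<n}" "S \<subseteq> {..<n}" for f :: "nat \<Rightarrow> nat" and S
  proof -
    have "\<exists>i<n. f i = y" if "y \<in> S" for y
    proof -
      have "y \<in> f ` {..<n}" using permutes_image[OF \<open>f permutes {..<n}\<close>] that \<open>S \<subseteq> {..<n}\<close> by auto
      then show ?thesis by auto
    qed
    then have "f ` {i. i < n \<and> f i \<in> S} = S" by auto
    moreover have "inj_on f {i. i < n \<and> f i \<in> S}" by (rule permutes_inj_on[OF that(1)])
    ultimately show ?thesis using card_image by fastforce
  qed
  have cardA: "card (A i j) = card (row_blockers (p i) (q j))"
    and cardB: "card (B i j) = card (col_blockers (p i) (q j))" if "i < n" "j < n" for i j
    unfolding A_def B_def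
    by (rule card_preimage[OF p row_blockers_subset] card_preimage[OF q col_blockers_subset]; use lt that in blast)+
  define first where "first \<sigma> x S \<longleftrightarrow> (\<forall>y\<in>S. \<sigma> x \<le> (\<sigma> y :: nat))" for \<sigma> and x :: nat and S
  have forced: "\<exists>i'<n. \<exists>j'<n. \<sigma> i' < \<sigma> i \<and> \<tau> j' < \<tau> j \<and> M $$ (i, j') = M $$ (i', j) \<and> M $$ (i', j') \<noteq> M $$ (i', j)"
    if ij: "i < n" "j < n" and late: "\<not> first \<sigma> i (A i j)" "\<not> first \<tau> j (B i j)" for \<sigma> \<tau> i j
  proof -
    obtain i' j' where "i' \<in> A i j" "\<sigma> i' < \<sigma> i" "j' \<in> B i j" "\<tau> j' < \<tau> j"
      using late by (auto simp: first_def not_le)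
    \<comment> \<open>The midpoint separates the two halves: the three entries are 1, 1, 0 if
      \<open>q j \<le> p i\<close>, and 0, 0, 1 otherwise.\<close>
    moreover from this have "M $$ (i, j') = M $$ (i', j) \<and> M $$ (i', j') \<noteq> M $$ (i', j)"
      using ij by (auto simp: A_def B_def M row_blockers_def col_blockers_def split: if_splits)
    ultimately show ?thesis by (auto simp: A_def B_def)
  qed
  have queries: "real (tree_queries M (scan_tree n (\<sigma>, \<tau>))) \<le>
      (\<Sum>i<n. \<Sum>j<n. of_bool (first \<sigma> i (A i j)) + of_bool (first \<tau> j (B i j)))"
    if "\<sigma> \<in> P" "\<tau> \<in> P" for \<sigma> \<tau>
  proof -
    define U where "U = {(i, j) \<in> {..<n} \<times> {..<n}.
    \<not> (\<exists>i'<n. \<exists>j'<n. \<sigma> i' < \<sigma> i \<and> \<tau> j' < \<tau> j \<and>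
         M $$ (i, j') = M $$ (i', j) \<and> M $$ (i', j') \<noteq> M $$ (i', j))}"
    have "real (tree_queries M (scan_tree n (\<sigma>, \<tau>))) \<le> real (card U)"
      using tree_queries_scan_tree_le[OF _ _ assms(1), of \<sigma> \<tau>] that by (simp add: P_def U_def)
    also have "\<dots> = (\<Sum>e\<in>{..<n} \<times> {..<n}. of_bool (e \<in> U))"
      by (subst sum_of_bool_eq) (auto simp: U_def intro!: arg_cong[where f = card])
    also have "\<dots> = (\<Sum>i<n. \<Sum>j<n. of_bool ((i, j) \<in> U))"
      unfolding sum.cartesian_product by (rule sum.cong) auto
    also have "\<dots> \<le> (\<Sum>i<n. \<Sum>j<n. of_bool (first \<sigma> i (A i j)) + of_bool (first \<tau> j (B i j)))"
    proof (intro sum_mono)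
      fix i j assume ij: "i \<in> {..<n}" "j \<in> {..<n}"
      have "(i, j) \<notin> U" if "\<not> first \<sigma> i (A i j)" "\<not> first \<tau> j (B i j)"
        using forced[OF _ _ that] ij by (simp add: U_def) blast
      then show "of_bool ((i, j) \<in> U) \<le> (of_bool (first \<sigma> i (A i j)) + of_bool (first \<tau> j (B i j)) :: real)"
        by (cases "first \<sigma> i (A i j)"; cases "first \<tau> j (B i j)") auto
    qed
    finally show ?thesis .
  qed
  have prob: "(\<Sum>\<sigma>\<in>P. of_bool (first \<sigma> x S)) \<le> real (card P) / real (card S + 1)"
    if "x < n" "S \<subseteq> {..<n}" "x \<notin> S" for x S
  proof -
    have "(\<Sum>\<sigma>\<in>P. of_bool (first \<sigma> x S)) = real (card {\<sigma>. \<sigma> permutes {..<n} \<and> (\<forall>y\<in>S. \<sigma> x \<le> \<sigma> y)})"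
      using finP by (subst sum_of_bool_eq) (auto simp: P_def first_def intro!: arg_cong[where f = card])
    also have "\<dots> \<le> real (card P) / real (card S + 1)"
    proof -
      have "card {\<sigma>. \<sigma> permutes {..<n} \<and> (\<forall>y\<in>S. \<sigma> x \<le> \<sigma> y)} * (card S + 1) \<le> card P"
        using card_permutes_first_le[of "{..<n}" x S] that by (simp only: cardP) simp
      then have "real (card {\<sigma>. \<sigma> permutes {..<n} \<and> (\<forall>y\<in>S. \<sigma> x \<le> \<sigma> y)}) * real (card S + 1) \<le> real (card P)"
        unfolding of_nat_mult[symmetric] of_nat_le_iff .
      then show ?thesis by (subst pos_le_divide_eq) auto
    qed
    finally show ?thesis .
  qed
  have pair: "(\<Sum>\<sigma>\<in>P. \<Sum>\<tau>\<in>P. of_bool (first \<sigma> i (A i j)) + of_bool (first \<tau> j (B i j))) \<le>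
      (real (card P))\<^sup>2 * (4 / real (gap (p i) (q j) + 1))" if ij: "i < n" "j < n" for i j
  proof -
    \<comment> \<open>\<open>card_permutes_first_le\<close> requires the row or column itself to lie
      outside its blockers, which the choice of the halves ensures.\<close>
    have "i \<notin> A i j" "j \<notin> B i j" "A i j \<subseteq> {..<n}" "B i j \<subseteq> {..<n}"
      using ij by (auto simp: A_def B_def row_blockers_def col_blockers_def split: if_splits)
    note prob' = prob[OF ij(1) this(3,1)] prob[OF ij(2) this(4,2)]
    \<comment> \<open>Each event depends on only one of the two orders, so the other contributes a
      factor \<open>card P\<close>.\<close>
    have "(\<Sum>\<sigma>\<in>P. \<Sum>\<tau>\<in>P. of_bool (first \<sigma> i (A i j)) + of_bool (first \<tau> j (B i j))) =
        real (card P) * (\<Sum>\<sigma>\<in>P. of_bool (first \<sigma> i (A i j))) + real (card P) * (\<Sum>\<tau>\<in>P. of_bool (first \<tau> j (B i j)))"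
      by (simp add: sum.distrib sum_distrib_left)
    also have "\<dots> \<le> real (card P) * (real (card P) / real (card (A i j) + 1)) + real (card P) * (real (card P) / real (card (B i j) + 1))"
      by (intro add_mono mult_left_mono prob') auto
    also have "\<dots> = (real (card P))\<^sup>2 * (1 / real (card (A i j) + 1) + 1 / real (card (B i j) + 1))"
      by (simp add: power2_eq_square distrib_left)
    also have "\<dots> \<le> (real (card P))\<^sup>2 * (4 / real (gap (p i) (q j) + 1))"
      unfolding cardA[OF ij] cardB[OF ij] by (intro mult_left_mono blockers_weight_le) simp
    finally show ?thesis .
  qed
  have "(\<Sum>s\<in>P \<times> P. real (tree_queries M (scan_tree n s))) = (\<Sum>\<sigma>\<in>P. \<Sum>\<tau>\<in>P. real (tree_queries M (scan_tree n (\<sigma>, \<tau>))))"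
    by (simp add: sum.cartesian_product)
  also have "\<dots> \<le> (\<Sum>\<sigma>\<in>P. \<Sum>\<tau>\<in>P. \<Sum>i<n. \<Sum>j<n. of_bool (first \<sigma> i (A i j)) + of_bool (first \<tau> j (B i j)))"
    by (intro sum_mono queries)
  also have "\<dots> = (\<Sum>\<sigma>\<in>P. \<Sum>i<n. \<Sum>j<n. \<Sum>\<tau>\<in>P. of_bool (first \<sigma> i (A i j)) + of_bool (first \<tau> j (B i j)))"
    by (subst sum.swap, subst (2) sum.swap) simp
  also have "\<dots> = (\<Sum>i<n. \<Sum>j<n. \<Sum>\<sigma>\<in>P. \<Sum>\<tau>\<in>P. of_bool (first \<sigma> i (A i j)) + of_bool (first \<tau> j (B i j)))"
    by (subst sum.swap, subst (2) sum.swap) simp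
  also have "\<dots> \<le> (\<Sum>i<n. \<Sum>j<n. (real (card P))\<^sup>2 * (4 / real (gap (p i) (q j) + 1)))"
    by (intro sum_mono pair) auto
  \<comment> \<open>Since \<open>p\<close> and \<open>q\<close> are bijections, summing over indices
    is the same as summing over ranks.\<close>
  also have "\<dots> = (\<Sum>x<n. \<Sum>y<n. (real (card P))\<^sup>2 * (4 / real (gap x y + 1)))"
    using sum.permute[OF p, of "\<lambda>x. \<Sum>j<n. (real (card P))\<^sup>2 * (4 / real (gap x (q j) + 1))"]
      sum.permute[OF q, of "\<lambda>y. (real (card P))\<^sup>2 * (4 / real (gap x y + 1))" for x]
    by (simp add: comp_def)
  also have "\<dots> = (real (card P))\<^sup>2 * (\<Sum>x<n. \<Sum>y<n. 4 / real (gap x y + 1))"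
    by (simp only: sum_distrib_left)
  also have "\<dots> \<le> (real (card P))\<^sup>2 * (8 * real n * harm n)"
    by (intro mult_left_mono sum_gap_le) simp
  also have "(real (card P))\<^sup>2 = real (card (P \<times> P))"
    by (simp add: power2_eq_square card_cartesian_product)
  finally show ?thesis .
qed

section \<open>Quantum simulation of decision trees\<close>

context
  notes One_nat_def [simp del]
begin

section \<open>Measurements and queries on basis states\<close>

lemma mult_smult_unit_vec:
  fixes A :: "'a :: comm_ring_1 mat"
  assumes "A \<in> carrier_mat m d" "l < d"
  shows "A *\<^sub>v (a \<cdot>\<^sub>v unit_vec d l) = a \<cdot>\<^sub>v col A l"
proof (rule eq_vecI)
  fix i assume "i < dim_vec (a \<cdot>\<^sub>v col A l)"
  then have "i < m" using assms by simp
  have "row A i \<bullet> (a \<cdot>\<^sub>v unit_vec d l) = a * (row A i \<bullet> unit_vec d l)"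
    using assms by simp
  then show "(A *\<^sub>v (a \<cdot>\<^sub>v unit_vec d l)) $ i = (a \<cdot>\<^sub>v col A l) $ i"
    using assms \<open>i < m\<close> by (simp add: scalar_prod_right_unit)
qed (use assms in auto)

text \<open>The operator \<open>|x><k|\<close>.\<close>

definition ket_bra :: "nat \<Rightarrow> nat \<Rightarrow> nat \<Rightarrow> complex mat" where
  "ket_bra d x k = mat d d (\<lambda>(r, c). if r = x \<and> c = k then 1 else 0)"

lemma ket_bra_mult_vec:
  assumes "k < d" "l < d"
  shows "ket_bra d x k *\<^sub>v (a \<cdot>\<^sub>v unit_vec d l) = (if k = l then a else 0) \<cdot>\<^sub>v unit_vec d x"
  using assms by (subst mult_smult_unit_vec[where m = d]) (auto simp: ket_bra_def unit_vec_def)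

lemma mat_adjoint_mult_index:
  assumes "A \<in> carrier_mat d d" "r < d" "c < d"
  shows "(mat_adjoint A * A) $$ (r, c) = (\<Sum>s<d. conjugate (A $$ (s, r)) * A $$ (s, c))"
  using assms by (simp add: mat_adjoint_def scalar_prod_def mat_of_rows_def lessThan_atLeast0)

text \<open>The adjoint of \<open>|x k><k|\<close> times itself is the projection onto basis state
  \<open>k\<close>, whatever \<open>x k\<close> is. Hence a measurement in the computational basis
  may reset the register to any basis state.\<close>

lemma is_measurement_ket_bra:
  assumes "\<And>k. k < d \<Longrightarrow> x k < d"
  shows "is_measurement d d (\<lambda>k. ket_bra d (x k) k)"
proof -
  have "(mat_adjoint (ket_bra d (x k) k) * ket_bra d (x k) k) $$ (r, c) = (if r = k \<and> c = k then 1 else 0)"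
    if "k < d" "r < d" "c < d" for k r c
  proof -
    have "(mat_adjoint (ket_bra d (x k) k) * ket_bra d (x k) k) $$ (r, c) =
        (\<Sum>s<d. conjugate (ket_bra d (x k) k $$ (s, r)) * ket_bra d (x k) k $$ (s, c))"
      using that by (intro mat_adjoint_mult_index) (auto simp: ket_bra_def)
    also have "\<dots> = (\<Sum>s<d. if s = x k then (if r = k \<and> c = k then 1 else 0) else 0)"
      by (rule sum.cong) (use that in \<open>auto simp: ket_bra_def\<close>)
    finally show ?thesis using assms that by simp
  qed
  then show ?thesis
    unfolding is_measurement_def by (auto simp: ket_bra_def intro!: eq_matI)
qed

text \<open>A measurement that ignores the state serves as the source of randomness.\<close>

lemma is_measurement_uniform:
  assumes "N > 0"
  shows "is_measurement d N (\<lambda>_. complex_of_real (sqrt (1 / real N)) \<cdot>\<^sub>m 1\<^sub>m d)"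
proof -
  let ?K = "complex_of_real (sqrt (1 / real N)) \<cdot>\<^sub>m 1\<^sub>m d"
  have "(mat_adjoint ?K * ?K) $$ (r, c) = (if r = c then 1 / of_nat N else 0)" if "r < d" "c < d" for r c
  proof -
    have "(mat_adjoint ?K * ?K) $$ (r, c) = (\<Sum>s<d. conjugate (?K $$ (s, r)) * ?K $$ (s, c))"
      using that by (intro mat_adjoint_mult_index) auto
    also have "\<dots> = (\<Sum>s<d. if s = r then (if r = c then 1 / of_nat N else 0) else 0)"
      by (rule sum.cong) (use that in \<open>auto simp flip: of_real_mult\<close>)
    finally show ?thesis using that by simp
  qed
  then show ?thesis
    using assms unfolding is_measurement_def by (auto intro!: eq_matI)
qed

lemma reg_code_1: "reg_code n 1 i j b w = (i * n + j) * 2 + b + w"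
  by (simp add: reg_code_def)

lemma reg_code_less:
  assumes "i < n" "j < n" "b < 2"
  shows "reg_code n 1 i j b 0 < reg_dim n 1"
proof -
  have "Suc i * n \<le> n * n" using assms by (intro mult_le_mono1) simp
  then show ?thesis using assms by (simp add: reg_code_1 reg_dim_def)
qed

lemma reg_code_inj:
  assumes "reg_code n 1 i j b 0 = reg_code n 1 i' j' b' 0" "j < n" "j' < n" "b < 2" "b' < 2"
  shows "i = i' \<and> j = j' \<and> b = b'"
proof -
  have *: "x = y \<and> b = b'" if "x * 2 + b = y * 2 + b'" for x y
    using that assms(4,5) by presburger
  then have b: "b = b'" and e: "i * n + j = i' * n + j'"
    using *[of "i * n + j" "i' * n + j'"] assms(1) unfolding reg_code_1 add_0_right by blast+
  have "j = j'" using arg_cong[OF e, of "\<lambda>k. k mod n"] assms(2,3) by simp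
  with e b assms(2) show ?thesis by simp
qed

text \<open>Target bit 0 suffices because the simulation resets the register before each query; the
  bound on the entry makes the reduction modulo 2 the identity.\<close>

lemma query_mat_mult_vec:
  assumes "i < n" "j < n" "M $$ (i, j) < 2"
  shows "query_mat n 1 M *\<^sub>v (a \<cdot>\<^sub>v unit_vec (reg_dim n 1) (reg_code n 1 i j 0 0)) =
    a \<cdot>\<^sub>v unit_vec (reg_dim n 1) (reg_code n 1 i j (M $$ (i, j)) 0)" (is "?Q *\<^sub>v (a \<cdot>\<^sub>v unit_vec ?d ?c) = a \<cdot>\<^sub>v unit_vec ?d ?r")
proof (rule eq_vecI)
  fix r assume "r < dim_vec (a \<cdot>\<^sub>v unit_vec ?d ?r)"
  then have r: "r < ?d" by simp
  have c: "?c < ?d" using assms by (simp add: reg_code_less)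
  have "?Q $$ (r, ?c) = (if r = ?r then 1 else 0)"
  proof -
    have "(\<exists>i'<n. \<exists>j'<n. \<exists>b<2. \<exists>w<1. ?c = reg_code n 1 i' j' b w \<and>
        r = reg_code n 1 i' j' ((b + M $$ (i', j')) mod 2) w) \<longleftrightarrow> r = ?r" (is "?L \<longleftrightarrow> _")
    proof
      assume ?L
      then show "r = ?r" using assms by (auto dest!: reg_code_inj)
    next
      assume "r = ?r"
      with assms show ?L by (intro exI[of _ i] exI[of _ j] exI[of _ 0] conjI) auto
    qed
    then show ?thesis using r c by (simp add: query_mat_def)
  qed
  moreover have "(?Q *\<^sub>v (a \<cdot>\<^sub>v unit_vec ?d ?c)) $ r = a * ?Q $$ (r, ?c)"
    using r c by (subst mult_smult_unit_vec[where m = ?d]) (auto simp: query_mat_def)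
  ultimately show "(?Q *\<^sub>v (a \<cdot>\<^sub>v unit_vec ?d ?c)) $ r = (a \<cdot>\<^sub>v unit_vec ?d ?r) $ r"
    using r by (auto simp: unit_vec_def)
qed (simp add: query_mat_def)

text \<open>The first measurement moves the register to the query position whatever the basis state was;
  the parity of the outcome of the second one is the answer bit.\<close>

primrec quantum_sim :: "nat \<Rightarrow> decision_tree \<Rightarrow> qprog" where
  "quantum_sim n (Answer X) = Output X"
| "quantum_sim n (Ask i j t0 t1) =
     Measure (reg_dim n 1) (\<lambda>k. ket_bra (reg_dim n 1) (reg_code n 1 i j 0 0) k) (\<lambda>_.
       Query (Measure (reg_dim n 1) (\<lambda>k. ket_bra (reg_dim n 1) 0 k) (\<lambda>k.
         if even k then quantum_sim n t0 else quantum_sim n t1)))"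

section \<open>Correctness and cost of the simulation\<close>

lemma valid_quantum_sim:
  "valid_tree n t \<Longrightarrow> valid_qprog (reg_dim n 1) (quantum_sim n t)"
proof (induction t)
  case (Ask i j t0 t1)
  then have "reg_code n 1 i j 0 0 < reg_dim n 1" by (simp add: reg_code_less)
  with Ask show ?case by (auto intro!: is_measurement_ket_bra)
qed simp

lemma sq_norm_unit_vec:
  assumes "l < d"
  shows "sq_norm_state (a \<cdot>\<^sub>v unit_vec d l) = (cmod a)\<^sup>2"
proof -
  have "(a \<cdot>\<^sub>v unit_vec d l) \<bullet>c (a \<cdot>\<^sub>v unit_vec d l) = (\<Sum>s<d. if s = l then a * cnj a else 0)"
    unfolding scalar_prod_def lessThan_atLeast0
    by (rule sum.cong) (auto simp: unit_vec_def)
  also have "\<dots> = of_real ((cmod a)\<^sup>2)" using assms by (subst complex_norm_square) simp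
  finally show ?thesis unfolding sq_norm_state_def by (simp del: of_real_power)
qed

text \<open>The state stays a multiple of a basis vector, so each measurement has at most one
  outcome of nonzero amplitude. With \<open>a\<close> arbitrary, the induction hypothesis also
  covers the outcomes of amplitude 0.\<close>

lemma output_prob_quantum_sim:
  assumes "valid_tree n t" "\<And>i j. i < n \<Longrightarrow> j < n \<Longrightarrow> M $$ (i, j) < 2" "l < reg_dim n 1"
  shows "output_prob (query_mat n 1 M) Y (quantum_sim n t) (a \<cdot>\<^sub>v unit_vec (reg_dim n 1) l) =
    (if tree_output M t = Y then (cmod a)\<^sup>2 else 0)"
  using assms(1,3)
proof (induction t arbitrary: a l)
  case (Answer X)
  then show ?case by (simp add: sq_norm_unit_vec)
next
  case (Ask i j t0 t1)
  let ?d = "reg_dim n 1" and ?t = "if M $$ (i, j) = 0 then t0 else t1"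
  let ?c = "\<lambda>b. reg_code n 1 i j b 0"
  have ij: "i < n" "j < n" and v: "valid_tree n t0" "valid_tree n t1" using Ask.prems by auto
  have M2: "M $$ (i, j) < 2" using assms(2) ij by simp
  then have lt: "?c 0 < ?d" "?c (M $$ (i, j)) < ?d" using ij by (simp_all add: reg_code_less)
  have d: "0 < ?d" using lt by simp
  have par: "even (?c (M $$ (i, j))) \<longleftrightarrow> M $$ (i, j) = 0" using M2 by (auto simp: reg_code_1)
  have inner: "(\<Sum>k<?d. output_prob (query_mat n 1 M) Y (if even k then quantum_sim n t0 else quantum_sim n t1)
      (ket_bra ?d 0 k *\<^sub>v (b \<cdot>\<^sub>v unit_vec ?d (?c (M $$ (i, j)))))) = (if tree_output M ?t = Y then (cmod b)\<^sup>2 else 0)"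
    (is "?S b = _") for b
  proof -
    have "?S b = (\<Sum>k<?d. if k = ?c (M $$ (i, j)) then (if tree_output M ?t = Y then (cmod b)\<^sup>2 else 0) else 0)"
      using par lt d by (intro sum.cong) (auto simp: ket_bra_mult_vec Ask.IH(1)[OF v(1) d] Ask.IH(2)[OF v(2) d])
    then show ?thesis using lt by simp
  qed
  have "output_prob (query_mat n 1 M) Y (quantum_sim n (Ask i j t0 t1)) (a \<cdot>\<^sub>v unit_vec ?d l) =
      (\<Sum>k<?d. ?S (if k = l then a else 0))"
    using Ask.prems(2) query_mat_mult_vec[of i n j M] ij M2
    by (auto simp: ket_bra_mult_vec if_distrib[of "quantum_sim n"] intro!: sum.cong)
  also have "\<dots> = (\<Sum>k<?d. if k = l then (if tree_output M ?t = Y then (cmod a)\<^sup>2 else 0) else 0)"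
    unfolding inner by (intro sum.cong) auto
  finally show ?case using Ask.prems by simp
qed

text \<open>Only outcome \<open>l\<close> of the first measurement keeps the amplitude, so the query
  counts with weight \<open>(cmod a)^2\<close>, as do all queries after it.\<close>

lemma expected_queries_quantum_sim:
  assumes "valid_tree n t" "\<And>i j. i < n \<Longrightarrow> j < n \<Longrightarrow> M $$ (i, j) < 2" "l < reg_dim n 1"
  shows "expected_queries (query_mat n 1 M) (quantum_sim n t) (a \<cdot>\<^sub>v unit_vec (reg_dim n 1) l) =
    (cmod a)\<^sup>2 * tree_queries M t"
  using assms(1,3)
proof (induction t arbitrary: a l)
  case (Answer X)
  then show ?case by simp
next
  case (Ask i j t0 t1)
  let ?d = "reg_dim n 1" and ?t = "if M $$ (i, j) = 0 then t0 else t1"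
  let ?c = "\<lambda>b. reg_code n 1 i j b 0"
  have ij: "i < n" "j < n" and v: "valid_tree n t0" "valid_tree n t1" using Ask.prems by auto
  have M2: "M $$ (i, j) < 2" using assms(2) ij by simp
  then have lt: "?c 0 < ?d" "?c (M $$ (i, j)) < ?d" using ij by (simp_all add: reg_code_less)
  have d: "0 < ?d" using lt by simp
  have par: "even (?c (M $$ (i, j))) \<longleftrightarrow> M $$ (i, j) = 0" using M2 by (auto simp: reg_code_1)
  have inner: "(\<Sum>k<?d. expected_queries (query_mat n 1 M) (if even k then quantum_sim n t0 else quantum_sim n t1)
      (ket_bra ?d 0 k *\<^sub>v (b \<cdot>\<^sub>v unit_vec ?d (?c (M $$ (i, j)))))) = (cmod b)\<^sup>2 * tree_queries M ?t"
    (is "?S b = _") for b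
  proof -
    have "?S b = (\<Sum>k<?d. if k = ?c (M $$ (i, j)) then (cmod b)\<^sup>2 * tree_queries M ?t else 0)"
      using par lt d by (intro sum.cong) (auto simp: ket_bra_mult_vec Ask.IH(1)[OF v(1) d] Ask.IH(2)[OF v(2) d])
    then show ?thesis using lt by simp
  qed
  have "expected_queries (query_mat n 1 M) (quantum_sim n (Ask i j t0 t1)) (a \<cdot>\<^sub>v unit_vec ?d l) =
      (\<Sum>k<?d. (cmod (if k = l then a else 0))\<^sup>2 + ?S (if k = l then a else 0))"
    using Ask.prems(2) query_mat_mult_vec[of i n j M] ij M2 lt
    by (auto simp: ket_bra_mult_vec sq_norm_unit_vec if_distrib[of "quantum_sim n"] intro!: sum.cong)
  also have "\<dots> = (\<Sum>k<?d. if k = l then (cmod a)\<^sup>2 * tree_queries M (Ask i j t0 t1) else 0)"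
    unfolding inner by (intro sum.cong) (auto simp: algebra_simps)
  finally show ?case using Ask.prems by simp
qed

text \<open>A list is used because measurement outcomes are numbered. The square root is the
  amplitude that gives each position of the list the probability
  \<open>1 / length ts\<close>.\<close>

definition quantum_mixture :: "nat \<Rightarrow> decision_tree list \<Rightarrow> qprog" where
  "quantum_mixture n ts = Measure (length ts)
     (\<lambda>_. complex_of_real (sqrt (1 / real (length ts))) \<cdot>\<^sub>m 1\<^sub>m (reg_dim n 1)) (\<lambda>k. quantum_sim n (ts ! k))"

lemma uniform_kraus_mult_vec:
  assumes "l < d"
  shows "(a \<cdot>\<^sub>m 1\<^sub>m d) *\<^sub>v unit_vec d l = (a :: complex) \<cdot>\<^sub>v unit_vec d l"
  using assms by (intro eq_vecI) (auto simp: scalar_prod_right_unit)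

lemma quantum_learner_mixture:
  assumes "n \<ge> 1" "ts \<noteq> []"
    and ts: "\<And>t. t \<in> set ts \<Longrightarrow> valid_tree n t \<and> (\<forall>M\<in>half_graph_mats n. tree_output M t = M)"
  shows "quantum_learner n 1 (quantum_mixture n ts)"
  unfolding quantum_learner_def
proof (intro conjI ballI)
  show "valid_qprog (reg_dim n 1) (quantum_mixture n ts)"
    using assms by (auto simp: quantum_mixture_def intro!: is_measurement_uniform valid_quantum_sim)
  fix M assume M: "M \<in> half_graph_mats n"
  have "reg_code n 1 0 0 0 0 < reg_dim n 1" using assms by (simp add: reg_code_less)
  then have "output_prob (query_mat n 1 M) M (quantum_mixture n ts) (initial_state n 1) =
      (\<Sum>k<length ts. 1 / real (length ts))"
    using M ts unfolding quantum_mixture_def initial_state_def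
    by (auto simp: uniform_kraus_mult_vec output_prob_quantum_sim half_graph_mats_lt_2 intro!: sum.cong
      simp flip: of_real_power)
  then show "output_prob (query_mat n 1 M) M (quantum_mixture n ts) (initial_state n 1) = 1"
    using assms by simp
qed simp

lemma quantum_expected_queries_mixture:
  assumes "n \<ge> 1" "ts \<noteq> []" "\<And>t. t \<in> set ts \<Longrightarrow> valid_tree n t" "M \<in> half_graph_mats n"
  shows "quantum_expected_queries n 1 M (quantum_mixture n ts) =
    (\<Sum>t\<leftarrow>ts. real (tree_queries M t)) / real (length ts)"
proof -
  have "reg_code n 1 0 0 0 0 < reg_dim n 1" using assms by (simp add: reg_code_less)
  then have "quantum_expected_queries n 1 M (quantum_mixture n ts) =
      (\<Sum>k<length ts. 1 / real (length ts) * real (tree_queries M (ts ! k)))"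
    using assms(3,4) unfolding quantum_mixture_def initial_state_def quantum_expected_queries_def
    by (auto simp: uniform_kraus_mult_vec expected_queries_quantum_sim half_graph_mats_lt_2 intro!: sum.cong)
  also have "\<dots> = (\<Sum>t\<leftarrow>ts. real (tree_queries M t)) / real (length ts)"
    by (simp add: sum_list_sum_nth sum_divide_distrib lessThan_atLeast0)
  finally show ?thesis .
qed

end

section \<open>Query complexity of learning half graphs\<close>

theorem theorem1p3:
  shows
    "(\<exists>(R :: nat \<Rightarrow> decision_tree pmf) (T :: nat \<Rightarrow> real).
        T \<in> O(\<lambda>n. real n * (log 2 (real n))\<^sup>2) \<and>
        (\<forall>n\<ge>1. randomized_learner n (R n) \<and>
          (\<forall>M \<in> half_graph_mats n. randomized_expected_queries M (R n) \<le> ennreal (T n)))) \<and>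
     (\<exists>(W :: nat \<Rightarrow> nat) (A :: nat \<Rightarrow> qprog) (T :: nat \<Rightarrow> real).
        T \<in> O(\<lambda>n. real n * log 2 (real n)) \<and>
        (\<forall>n\<ge>1. quantum_learner n (W n) (A n) \<and>
          (\<forall>M \<in> half_graph_mats n. quantum_expected_queries n (W n) M (A n) \<le> T n)))"
proof -
  \<comment> \<open>One bound serves both claims, as \<open>n log n\<close> lies below the order
    required of the randomized algorithm.\<close>
  define T :: "nat \<Rightarrow> real" where "T n = 8 * real n * harm n" for n
  define P where "P n = {\<sigma>. \<sigma> permutes {..<n}} \<times> {\<sigma>. \<sigma> permutes {..<n}}" for n :: nat
  have T: "T \<in> O(\<lambda>n. real n * log 2 (real n))"
    unfolding T_def mult.assoc using harm_bigo by (simp add: landau_o.big.mult_left)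
  also have "(\<lambda>n::nat. real n * log 2 (real n)) \<in> O(\<lambda>n. real n * (log 2 (real n))\<^sup>2)" by real_asymp
  finally have T': "T \<in> O(\<lambda>n. real n * (log 2 (real n))\<^sup>2)" .
  have P: "finite (P n)" "P n \<noteq> {}" for n
    using permutes_id[of "{..<n}"] unfolding P_def by (auto simp: finite_permutations intro!: exI[of _ id])
  have tree: "valid_tree n (scan_tree n s)" "M \<in> half_graph_mats n \<Longrightarrow> tree_output M (scan_tree n s) = M"
    if "s \<in> P n" for n s M
    using that by (auto simp: P_def valid_scan_tree tree_output_scan_tree)
  have avg: "(\<Sum>s\<in>P n. real (tree_queries M (scan_tree n s))) / real (card (P n)) \<le> T n"
    if "M \<in> half_graph_mats n" for n M
    using sum_permutes_scan_tree_le[OF that] P[of n]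
    by (simp add: P_def[symmetric] T_def divide_le_eq card_gt_0_iff mult.commute)
  define R where "R n = map_pmf (scan_tree n) (pmf_of_set (P n))" for n
  have R: "randomized_learner n (R n)" for n
    using P[of n] tree[of _ n] by (auto simp: randomized_learner_def R_def)
  have "randomized_expected_queries M (R n) \<le> ennreal (T n)" if "M \<in> half_graph_mats n" for n M
  proof -
    have "randomized_expected_queries M (R n) =
        (\<Sum>s\<in>P n. ennreal (real (tree_queries M (scan_tree n s)))) / card (P n)"
      using P[of n] by (simp add: randomized_expected_queries_def R_def nn_integral_pmf_of_set)
    also have "\<dots> = ennreal ((\<Sum>s\<in>P n. real (tree_queries M (scan_tree n s))) / real (card (P n)))"
      unfolding ennreal_of_nat_eq_real_of_nat using P[of n]
      by (subst sum_ennreal, simp, subst divide_ennreal) (auto simp: sum_nonneg card_gt_0_iff)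
    also have "\<dots> \<le> ennreal (T n)" using avg[OF that] by (rule ennreal_leI)
    finally show ?thesis .
  qed
  with T' R have randomized: "\<exists>(R :: nat \<Rightarrow> decision_tree pmf) (T :: nat \<Rightarrow> real).
        T \<in> O(\<lambda>n. real n * (log 2 (real n))\<^sup>2) \<and>
        (\<forall>n\<ge>1. randomized_learner n (R n) \<and>
          (\<forall>M \<in> half_graph_mats n. randomized_expected_queries M (R n) \<le> ennreal (T n)))"
    by blast
  \<comment> \<open>Enumerating \<open>P n\<close> without repetition turns the mean over the list
    into the uniform average over pairs of orders.\<close>
  obtain xs where xs: "set (xs n) = P n" "distinct (xs n)" for n
    using finite_distinct_list[OF P(1)] by metis
  define A where "A n = quantum_mixture n (map (scan_tree n) (xs n))" for n
  have ne: "map (scan_tree n) (xs n) \<noteq> []" for n using P(2)[of n] xs(1)[of n] by auto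
  have "quantum_learner n 1 (A n)" if "n \<ge> 1" for n
    unfolding A_def using that ne tree xs(1) by (intro quantum_learner_mixture) auto
  moreover have "quantum_expected_queries n 1 M (A n) \<le> T n" if "n \<ge> 1" "M \<in> half_graph_mats n" for n M
  proof -
    have "quantum_expected_queries n 1 M (A n) =
        (\<Sum>t\<leftarrow>map (scan_tree n) (xs n). real (tree_queries M t)) / real (length (xs n))"
      unfolding A_def using that ne tree xs(1) by (subst quantum_expected_queries_mixture) auto
    also have "\<dots> = (\<Sum>s\<in>P n. real (tree_queries M (scan_tree n s))) / real (card (P n))"
      using xs[of n] by (simp add: comp_def sum_list_distinct_conv_sum_set distinct_card flip: xs(1))
    also have "\<dots> \<le> T n" by (rule avg[OF that(2)])
    finally show ?thesis .
  qed
  ultimately have "\<exists>(W :: nat \<Rightarrow> nat) (A :: nat \<Rightarrow> qprog) (T :: nat \<Rightarrow> real).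
        T \<in> O(\<lambda>n. real n * log 2 (real n)) \<and>
        (\<forall>n\<ge>1. quantum_learner n (W n) (A n) \<and>
          (\<forall>M \<in> half_graph_mats n. quantum_expected_queries n (W n) M (A n) \<le> T n))"
    using T by (intro exI[of _ "\<lambda>_. 1"] exI[of _ A] exI[of _ T]) auto
  with randomized show ?thesis by blast
qed

end
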